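(* Let $\ell\geq0$, $n\geq1$ and $(J,X_0,\dots,X_\ell)\in\mathcal S^n_\ell$, i.e., $J,X_0,\dots,X_\ell\in\mathbb R^{n,n}$ with $J^\top=-J$ and $X_i^\top=X_i\geq0$ for $i=0,\dots,\ell$. Then the infimum defining the structured distance $d_{\mathrm{ck}}^{\mathcal S}(J,X_0,\dots,X_\ell)$ to the common kernel is attained at $\Delta_J=\Delta_J^u$, $\Delta_{X_0}=\Delta_{X_0}^u,\dots,\Delta_{X_\ell}=\Delta_{X_\ell}^u$ for some $u\in\mathbb R^n$ with $\|u\|_2=1$, where $$\Delta_J^u:=-uu^\top J-Juu^\top,\qquad \Delta_{X_i}^u:=-uu^\top X_i-X_iuu^\top+uu^\top X_iuu^\top,\quad i=0,\dots,\ell.$$ Consequently, $$d_{\mathrm{ck}}^{\mathcal S}(J,X_0,\dots,X_\ell)=\min_{u\in\mathbb R^n,\ \|u\|=1}\left(2\|Ju\|_2^2+\sum_{i=0}^\ell\Big(2\|(I-uu^\top)X_iu\|_2^2+(u^\top X_iu)^2\Big)\right)^{1/2},$$ and in addition $$\sqrt{\lambda_{\min}(-J^2+X_0^2+\cdots+X_\ell^2)}\leq d_{\mathrm{ck}}^{\mathcal S}(J,X_0,\dots,X_\ell)\leq\sqrt{2\cdot\lambda_{\min}(-J^2+X_0^2+\cdots+X_\ell^2)}.$$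
   Context: $X\geq0$ means that the symmetric matrix $X$ is positive semidefinite; $\lambda_{\min}(X)$ is its smallest eigenvalue; $\|\cdot\|_F$ is the Frobenius norm. $\mathcal S^n_\ell$ is the set of $(\ell+2)$-tuples $(J,X_0,\dots,X_\ell)$ of real $n\times n$ matrices with $J^\top=-J$ and $X_i=X_i^\top\geq0$ for $i=0,\dots,\ell$. For such a tuple, the structured distance to the common kernel $d_{\mathrm{ck}}^{\mathcal S}(J,X_0,\dots,X_\ell)$ is the infimum of $\|[\Delta_J,\Delta_{X_0},\dots,\Delta_{X_\ell}]\|_F$ over all real $n\times n$ matrices $\Delta_J,\Delta_{X_0},\dots,\Delta_{X_\ell}$ such that $(J+\Delta_J,X_0+\Delta_{X_0},\dots,X_\ell+\Delta_{X_\ell})\in\mathcal S^n_\ell$ and $\ker(J+\Delta_J)\cap\bigcap_{i=0}^\ell\ker(X_i+\Delta_{X_i})\neq\{0\}$. *)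

theory Defs
  imports "HOL-Analysis.Analysis"
begin

definition psd :: "real^'n^'n \<Rightarrow> bool" where
  "psd A \<longleftrightarrow> transpose A = A \<and> (\<forall>x. 0 \<le> x \<bullet> (A *v x))"

definition mat_ker :: "real^'n^'m \<Rightarrow> (real^'n) set" where
  "mat_ker A = {x. A *v x = 0}"

definition eigenvalue :: "real^'n^'n \<Rightarrow> real \<Rightarrow> bool" where
  "eigenvalue A c \<longleftrightarrow> (\<exists>v. v \<noteq> 0 \<and> A *v v = c *\<^sub>R v)"

(* Meaningful only if A has a real eigenvalue; used only for symmetric A. *)
definition lambda_min :: "real^'n^'n \<Rightarrow> real" where
  "lambda_min A = (LEAST c. eigenvalue A c)"

(* A tuple (J, X_0, ..., X_l) is encoded as a pair (J, X) with X :: nat => matrix;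
   only the values X 0, ..., X l matter. *)
definition structured_tuples :: "nat \<Rightarrow> ((real^'n^'n) \<times> (nat \<Rightarrow> real^'n^'n)) set" where
  "structured_tuples l = {(J, X). transpose J = - J \<and> (\<forall>i\<le>l. psd (X i))}"

(* Frobenius norm of the block matrix [D, E_0, ..., E_l]; the norm of the type
   real^'n^'n is itself the Frobenius norm, as the lemma below confirms. *)
definition block_norm :: "nat \<Rightarrow> real^'n^'n \<Rightarrow> (nat \<Rightarrow> real^'n^'n) \<Rightarrow> real" where
  "block_norm l D E = sqrt ((norm D)\<^sup>2 + (\<Sum>i\<le>l. (norm (E i))\<^sup>2))"

lemma norm_matrix_eq_frobenius:
  fixes A :: "real^'n^'m"
  shows "norm A = sqrt (\<Sum>p\<in>UNIV. \<Sum>q\<in>UNIV. (A $ p $ q)\<^sup>2)"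
  by (simp add: norm_vec_def L2_set_def sum_nonneg)

definition ck_perturbations ::
  "nat \<Rightarrow> real^'n^'n \<Rightarrow> (nat \<Rightarrow> real^'n^'n) \<Rightarrow> ((real^'n^'n) \<times> (nat \<Rightarrow> real^'n^'n)) set" where
  "ck_perturbations l J X =
     {(D, E). (J + D, \<lambda>i. X i + E i) \<in> structured_tuples l \<and>
              mat_ker (J + D) \<inter> (\<Inter>i\<le>l. mat_ker (X i + E i)) \<noteq> {0}}"

(* The infimum is over a nonempty set (take D = -J, E i = -X i) bounded below by 0. *)
definition d_ck :: "nat \<Rightarrow> real^'n^'n \<Rightarrow> (nat \<Rightarrow> real^'n^'n) \<Rightarrow> real" where
  "d_ck l J X = (INF (D, E)\<in>ck_perturbations l J X. block_norm l D E)"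

(* u u^T *)
definition outer :: "real^'n \<Rightarrow> real^'n^'n" where
  "outer u = (\<chi> p q. u $ p * u $ q)"

definition Delta_J :: "real^'n \<Rightarrow> real^'n^'n \<Rightarrow> real^'n^'n" where
  "Delta_J u J = - (outer u ** J) - J ** outer u"

definition Delta_X :: "real^'n \<Rightarrow> real^'n^'n \<Rightarrow> real^'n^'n" where
  "Delta_X u A = - (outer u ** A) - A ** outer u + outer u ** A ** outer u"

definition ck_objective :: "nat \<Rightarrow> real^'n^'n \<Rightarrow> (nat \<Rightarrow> real^'n^'n) \<Rightarrow> real^'n \<Rightarrow> real" where
  "ck_objective l J X u =
     sqrt (2 * (norm (J *v u))\<^sup>2 +
           (\<Sum>i\<le>l. (2 * (norm ((mat 1 - outer u) *v (X i *v u)))\<^sup>2 + (u \<bullet> (X i *v u))\<^sup>2)))"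

end

theory Submission
  imports Defs
begin

text \<open>Fix a unit vector \<open>u\<close>, write \<open>P = I - u u\<^sup>T\<close>, and ask for the cheapest perturbation that
puts \<open>u\<close> into the common kernel. In an orthonormal basis that starts with \<open>u\<close>, a perturbation
\<open>D\<close> of a matrix \<open>A\<close> must have the first column \<open>- A u\<close>. If \<open>D\<close> is symmetric or
skew-symmetric, this also fixes its first row, and only the remaining block \<open>P D P\<close> is
free. The Frobenius norm is least when that block vanishes
(\<open>norm_perturbation_sq_ge\<close>, \<open>norm_Delta_X_sq\<close>). This best choice replaces \<open>A\<close> by the
compression \<open>P A P\<close> (\<open>add_Delta_X\<close>), and compressions of skew-symmetric or positive
semidefinite matrices are again of that kind. So the structure does not obstruct the optimum, all
blocks \<open>J, X 0, \<dots>, X l\<close> can be optimised separately, and the squared cost of \<open>u\<close> is the sum of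
\<open>2 |A u|\<^sup>2 - (u \<bullet> A u)\<^sup>2\<close> over the blocks \<open>A\<close>, with \<open>u \<bullet> J u = 0\<close>.

Every admissible perturbation has a unit vector \<open>u\<close> in the perturbed common kernel and costs at least
as much as the best one for that \<open>u\<close>. Therefore the distance is the infimum of the cost over the
unit sphere, and it is attained by compactness.

For the eigenvalue bounds, the quadratic form of \<open>- J\<^sup>2 + \<Sum> X i\<^sup>2\<close> at \<open>u\<close> is
\<open>q u = |J u|\<^sup>2 + \<Sum> |X i u|\<^sup>2\<close>. As \<open>0 \<le> (u \<bullet> X i u)\<^sup>2 \<le> |X i u|\<^sup>2\<close>, the squared
cost lies between \<open>q u\<close> and \<open>2 q u\<close>, and the minimum of \<open>q\<close> over the unit sphere is the smallest eigenvalue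
(\<open>lambda_min_Rayleigh\<close>).\<close>

section \<open>Rank-one projections and the Frobenius norm\<close>

lemma outer_mult_vec: "outer u *v x = (u \<bullet> x) *\<^sub>R u"
  by (simp add: outer_def vec_eq_iff matrix_vector_mult_def inner_vec_def sum_distrib_left
      sum_distrib_right mult_ac)

definition perp_proj :: "real^'n \<Rightarrow> real^'n^'n" where
  "perp_proj u = mat 1 - outer u"

lemma perp_proj_mult_vec: "perp_proj u *v x = x - (u \<bullet> x) *\<^sub>R u"
  by (simp add: perp_proj_def matrix_vector_mult_diff_rdistrib outer_mult_vec)

lemma transpose_perp_proj [simp]: "transpose (perp_proj u) = perp_proj u"
  by (simp add: perp_proj_def transpose_def outer_def vec_eq_iff mat_def mult.commute)

lemma uminus_matrix_mult_vec: "(- A) *v x = - (A *v (x :: real^'n))"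
  by (simp add: matrix_vector_mult_def vec_eq_iff sum_negf)

lemma inner_mult_vec_transpose: "x \<bullet> (A *v y) = (transpose A *v x) \<bullet> (y :: real^'n)"
  by (simp add: dot_lmul_matrix)

lemma transpose_uminus: "transpose (- A) = - transpose (A :: real^'n^'m)"
  by (simp add: transpose_def vec_eq_iff)

lemma transpose_add: "transpose (A + B) = transpose A + transpose (B :: real^'n^'m)"
  by (simp add: transpose_def vec_eq_iff)

lemma norm_perp_proj_sq:
  assumes "norm u = 1"
  shows "(norm (perp_proj u *v x))\<^sup>2 = (norm x)\<^sup>2 - (u \<bullet> x)\<^sup>2"
proof -
  have "u \<bullet> u = 1" using assms by (simp add: norm_eq_1)
  then show ?thesis
    unfolding power2_norm_eq_inner perp_proj_mult_vec
    by (simp add: inner_diff inner_commute power2_eq_square algebra_simps)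
qed

lemma norm_matrix_sq_rows: "(norm (D :: real^'n^'m))\<^sup>2 = (\<Sum>p\<in>UNIV. (norm (D $ p))\<^sup>2)"
  unfolding power2_norm_eq_inner by (simp add: inner_vec_def)

lemma norm_transpose: "norm (transpose D) = norm (D :: real^'n^'m)"
  unfolding norm_matrix_eq_frobenius transpose_def by simp (rule sum.swap)

text \<open>Each row of \<open>D ** perp_proj u\<close> is the projection of the corresponding row of \<open>D\<close>, so this is
Pythagoras summed over the rows.\<close>
lemma norm_matrix_split_right:
  fixes D :: "real^'n^'m"
  assumes "norm u = 1"
  shows "(norm D)\<^sup>2 = (norm (D ** perp_proj u))\<^sup>2 + (norm (D *v u))\<^sup>2"
proof -
  have row: "(D ** perp_proj u) $ p = perp_proj u *v (D $ p)" for p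
  proof -
    have "(D ** perp_proj u) $ p = transpose (perp_proj u) *v (D $ p)"
      by (simp only: vec_eq_iff matrix_matrix_mult_def matrix_vector_mult_def transpose_def)
         (simp add: mult.commute)
    then show ?thesis by (simp only: transpose_perp_proj)
  qed
  have "(D *v u) $ p = u \<bullet> (D $ p)" for p
    by (simp add: matrix_vector_mul_component inner_commute)
  then have "(norm (D *v u))\<^sup>2 = (\<Sum>p\<in>UNIV. (u \<bullet> (D $ p))\<^sup>2)"
    unfolding power2_norm_eq_inner inner_vec_def[of "D *v u"] by (simp add: power2_eq_square)
  then show ?thesis
    unfolding norm_matrix_sq_rows[of D] norm_matrix_sq_rows[of "D ** perp_proj u"] row
      norm_perp_proj_sq[OF assms]
    by (simp add: sum_subtractf)
qed

text \<open>The Frobenius norm in an orthonormal basis that starts with \<open>u\<close>: free block, first column and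
first row, where the corner entry \<open>u \<bullet> (D *v u)\<close> belongs to both column and row and has to be
subtracted once. It follows by splitting off \<open>u\<close> first on the left and then on the right.\<close>
lemma norm_matrix_split:
  fixes D :: "real^'n^'n"
  assumes "norm u = 1"
  shows "(norm D)\<^sup>2 = (norm (perp_proj u ** D ** perp_proj u))\<^sup>2
           + (norm (D *v u))\<^sup>2 + (norm (transpose D *v u))\<^sup>2 - (u \<bullet> (D *v u))\<^sup>2"
proof -
  let ?P = "perp_proj u"
  have "(norm D)\<^sup>2 = (norm (transpose D))\<^sup>2" by (simp only: norm_transpose)
  also have "\<dots> = (norm (transpose D ** ?P))\<^sup>2 + (norm (transpose D *v u))\<^sup>2"
    by (rule norm_matrix_split_right[OF assms])
  also have "transpose D ** ?P = transpose (?P ** D)"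
    by (simp only: matrix_transpose_mul transpose_perp_proj)
  also have "norm (transpose (?P ** D)) = norm (?P ** D)" by (rule norm_transpose)
  also have "(norm (?P ** D))\<^sup>2 = (norm (?P ** D ** ?P))\<^sup>2 + (norm (?P *v (D *v u)))\<^sup>2"
    using norm_matrix_split_right[OF assms, of "?P ** D"] by (simp only: matrix_vector_mul_assoc)
  finally show ?thesis by (simp add: norm_perp_proj_sq[OF assms])
qed

section \<open>The smallest structured perturbation with a prescribed kernel vector\<close>

text \<open>The source of the formula for \<open>Delta_X\<close>: it is what turns \<open>A\<close> into its compression to the
orthogonal complement of \<open>u\<close>.\<close>
lemma add_Delta_X: "A + Delta_X u A = perp_proj u ** A ** perp_proj u"
  unfolding matrix_eq Delta_X_def
  by (simp add: matrix_vector_mult_add_rdistrib matrix_vector_mult_diff_rdistrib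
      uminus_matrix_mult_vec outer_mult_vec perp_proj_mult_vec
      matrix_vector_mult_diff_distrib matrix_vector_mult_scaleR inner_diff_right
      flip: matrix_vector_mul_assoc) (simp add: algebra_simps)

lemma Delta_X_mult_kernel_vec:
  assumes "norm u = 1"
  shows "(A + Delta_X u A) *v u = 0"
  using assms unfolding add_Delta_X
  by (simp add: perp_proj_mult_vec norm_eq_1 flip: matrix_vector_mul_assoc)

lemma inner_skew_eq_0:
  assumes "transpose J = - (J :: real^'n^'n)"
  shows "u \<bullet> (J *v u) = 0"
  using inner_mult_vec_transpose[of u J u]
  by (simp only: assms uminus_matrix_mult_vec) (simp add: inner_commute)

text \<open>Both kinds of blocks are handled by the same lemmas, because the extra term
\<open>u u\<^sup>T J u u\<^sup>T = (u \<bullet> J u) u u\<^sup>T\<close> vanishes for skew-symmetric \<open>J\<close>.\<close>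
lemma Delta_J_eq_Delta_X:
  assumes "transpose J = - J"
  shows "Delta_J u J = Delta_X u J"
  unfolding matrix_eq Delta_J_def Delta_X_def
  by (simp add: matrix_vector_mult_add_rdistrib matrix_vector_mult_diff_rdistrib
      outer_mult_vec matrix_vector_mult_scaleR inner_skew_eq_0[OF assms]
      flip: matrix_vector_mul_assoc)

lemma norm_sq_symmetric_or_skew:
  fixes D :: "real^'n^'n"
  assumes "norm u = 1" and "transpose D = D \<or> transpose D = - D"
  shows "(norm D)\<^sup>2 = (norm (perp_proj u ** D ** perp_proj u))\<^sup>2
           + 2 * (norm (D *v u))\<^sup>2 - (u \<bullet> (D *v u))\<^sup>2"
proof -
  have "norm (transpose D *v u) = norm (D *v u)"
    using assms(2) by (elim disjE) (simp_all only: uminus_matrix_mult_vec norm_minus_cancel)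
  then show ?thesis using norm_matrix_split[OF assms(1), of D] by simp
qed

text \<open>Column and row of \<open>D\<close> at \<open>u\<close> are forced by the kernel condition and the symmetry; the bound drops
the free block.\<close>
lemma norm_perturbation_sq_ge:
  fixes A D :: "real^'n^'n"
  assumes "norm u = 1" and "transpose D = D \<or> transpose D = - D"
    and ker: "(A + D) *v u = 0"
  shows "2 * (norm (A *v u))\<^sup>2 - (u \<bullet> (A *v u))\<^sup>2 \<le> (norm D)\<^sup>2"
proof -
  have "D *v u = - (A *v u)"
    using ker by (simp add: matrix_vector_mult_add_rdistrib eq_neg_iff_add_eq_0 add.commute)
  then show ?thesis using norm_sq_symmetric_or_skew[OF assms(1,2)] by simp
qed

lemma transpose_compression:
  "transpose (perp_proj u ** A ** perp_proj u) = perp_proj u ** transpose A ** perp_proj u"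
  by (simp only: matrix_transpose_mul transpose_perp_proj matrix_mul_assoc)

lemma matrix_mult_uminus_middle: "A ** (- B) ** C = - (A ** B ** (C :: real^'n^'n))"
  for A B :: "real^'n^'n"
  unfolding matrix_eq
  by (simp add: uminus_matrix_mult_vec vec.neg flip: matrix_vector_mul_assoc)

text \<open>The lower bound for perturbations with \<open>u\<close> in the kernel is sharp, since the free block of
\<open>Delta_X u A\<close> is \<open>P (P A P - A) P = 0\<close>.\<close>
lemma norm_Delta_X_sq:
  fixes A :: "real^'n^'n"
  assumes u: "norm u = 1" and A: "transpose A = A \<or> transpose A = - A"
  shows "(norm (Delta_X u A))\<^sup>2 = 2 * (norm (A *v u))\<^sup>2 - (u \<bullet> (A *v u))\<^sup>2"
proof -
  let ?P = "perp_proj u" and ?D = "Delta_X u A"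
  have uu: "u \<bullet> u = 1" using u by (simp add: norm_eq_1)
  have D: "?D = ?P ** A ** ?P + - A" using add_Delta_X[of A u] by (simp add: algebra_simps)
  have "transpose ?D = ?D \<or> transpose ?D = - ?D"
    using A unfolding D transpose_add transpose_uminus transpose_compression
    by (elim disjE) (simp_all add: matrix_mult_uminus_middle)
  moreover have "?P ** ?D ** ?P = 0"
    unfolding matrix_eq D
    by (simp add: matrix_vector_mult_add_rdistrib uminus_matrix_mult_vec perp_proj_mult_vec
        inner_diff_right uu matrix_vector_mult_diff_distrib matrix_vector_mult_scaleR
        inner_add_right algebra_simps flip: matrix_vector_mul_assoc)
  moreover have "?D *v u = - (A *v u)"
    using Delta_X_mult_kernel_vec[OF u, of A]
    by (simp add: matrix_vector_mult_add_rdistrib eq_neg_iff_add_eq_0 add.commute)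
  ultimately show ?thesis using norm_sq_symmetric_or_skew[OF u] by simp
qed

lemma psd_compression:
  assumes "psd A"
  shows "psd (perp_proj u ** A ** perp_proj u)"
proof -
  let ?P = "perp_proj u"
  have "x \<bullet> ((?P ** A ** ?P) *v x) = (?P *v x) \<bullet> (A *v (?P *v x))" for x
    using inner_mult_vec_transpose[of x ?P "A *v (?P *v x)"]
    by (simp only: transpose_perp_proj matrix_vector_mul_assoc matrix_mul_assoc)
  then show ?thesis using assms unfolding psd_def transpose_compression by simp
qed

section \<open>The smallest eigenvalue as a minimum of the quadratic form\<close>

text \<open>A zero of a nonnegative quadratic form is a minimum, so the form has zero derivative there. The proof
tests this in the direction \<open>- N u\<close>.\<close>
lemma psd_form_eq_0_imp_kernel:
  assumes "psd N" and "u \<bullet> (N *v u) = 0"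
  shows "N *v u = 0"
proof -
  define w where "w = N *v u"
  define a where "a = w \<bullet> w"
  define b where "b = w \<bullet> (N *v w)"
  have b: "b \<ge> 0" using assms(1) by (simp add: psd_def b_def)
  have uw: "u \<bullet> (N *v w) = a"
    using assms(1) by (simp only: psd_def inner_mult_vec_transpose a_def w_def)
  have quad: "0 \<le> t * t * b - 2 * t * a" for t
  proof -
    have "0 \<le> (u - t *\<^sub>R w) \<bullet> (N *v (u - t *\<^sub>R w))" using assms(1) by (simp add: psd_def)
    also have "\<dots> = t * t * b - 2 * t * a"
      using assms(2) uw
      by (simp add: matrix_vector_mult_diff_distrib matrix_vector_mult_scaleR inner_diff
          flip: w_def a_def b_def) (simp add: algebra_simps)
    finally show ?thesis .
  qed
  \<comment> \<open>The minimising step \<open>a / b\<close> may divide by zero; the shorter step \<open>a / (b + 1)\<close> still gives a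
    negative value unless \<open>a = 0\<close>.\<close>
  define t where "t = a / (b + 1)"
  have a: "a = t * (b + 1)" using b by (simp add: t_def)
  have "t\<^sup>2 * (b + 2) \<le> 0" using quad[of t] by (simp add: a power2_eq_square algebra_simps)
  then have "t\<^sup>2 \<le> 0" using b by (simp add: mult_le_0_iff)
  then have "a = 0" by (simp add: a)
  then show ?thesis by (simp add: a_def w_def)
qed

text \<open>A minimiser \<open>u\<close> of the form on the compact unit sphere, with value \<open>m\<close>, makes \<open>M - m I\<close> positive
semidefinite with a zero of its form at \<open>u\<close>; hence \<open>u\<close> is an eigenvector. This also shows that
the least eigenvalue in the definition of \<open>lambda_min\<close> exists.\<close>
lemma lambda_min_Rayleigh:
  fixes M :: "real^'n^'n"
  assumes sym: "transpose M = M"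
  shows "\<exists>u. norm u = 1 \<and> u \<bullet> (M *v u) = lambda_min M"
    and "\<And>v. norm v = 1 \<Longrightarrow> lambda_min M \<le> v \<bullet> (M *v v)"
proof -
  let ?S = "sphere (0 :: real^'n) 1"
  have "\<exists>u\<in>?S. \<forall>v\<in>?S. u \<bullet> (M *v u) \<le> v \<bullet> (M *v v)"
    by (rule continuous_attains_inf) (auto intro!: continuous_intros)
  then obtain u where u: "norm u = 1"
    and min: "\<And>v. norm v = 1 \<Longrightarrow> u \<bullet> (M *v u) \<le> v \<bullet> (M *v v)" by auto
  define m where "m = u \<bullet> (M *v u)"
  define N where "N = M - m *\<^sub>R mat 1"
  have uu: "u \<bullet> u = 1" using u by (simp add: norm_eq_1)
  have N: "N *v x = M *v x - m *\<^sub>R x" for x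
    by (simp add: N_def matrix_vector_mult_diff_rdistrib flip: scaleR_matrix_vector_assoc)
  have "m * (x \<bullet> x) \<le> x \<bullet> (M *v x)" for x
  proof (cases "x = 0")
    case False
    then have "m \<le> (x /\<^sub>R norm x) \<bullet> (M *v (x /\<^sub>R norm x))"
      unfolding m_def by (intro min) simp
    also have "\<dots> = (x \<bullet> (M *v x)) / (x \<bullet> x)"
      by (simp add: matrix_vector_mult_scaleR divide_inverse norm_eq_sqrt_inner flip: mult.assoc)
         (simp add: mult.commute flip: inverse_mult_distrib)
    finally show ?thesis using False by (simp add: pos_le_divide_eq)
  qed simp
  moreover have "transpose N = N"
    using sym by (simp add: N_def transpose_def vec_eq_iff mat_def)
  ultimately have "psd N" by (simp add: psd_def N inner_diff_right)
  then have "N *v u = 0"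
    by (rule psd_form_eq_0_imp_kernel) (simp add: N inner_diff_right uu m_def)
  then have ev: "eigenvalue M m"
    unfolding eigenvalue_def using u by (intro exI[of _ u]) (auto simp: N)
  have le: "m \<le> c" if "eigenvalue M c" for c
  proof -
    from that obtain v where v: "v \<noteq> 0" "M *v v = c *\<^sub>R v" by (auto simp: eigenvalue_def)
    have "m * (v \<bullet> v) \<le> c * (v \<bullet> v)" using \<open>m * (v \<bullet> v) \<le> v \<bullet> (M *v v)\<close> v(2) by simp
    then show ?thesis using v(1) by simp
  qed
  have "lambda_min M = m"
    unfolding lambda_min_def by (rule Least_equality[where P = "eigenvalue M"]) (fact ev, fact le)
  then show "\<exists>u. norm u = 1 \<and> u \<bullet> (M *v u) = lambda_min M"
    and "\<And>v. norm v = 1 \<Longrightarrow> lambda_min M \<le> v \<bullet> (M *v v)"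
    using u min by (auto simp: m_def)
qed

section \<open>The structured distance\<close>

text \<open>Without the projection in its definition the objective is visibly continuous in \<open>u\<close>, and it matches the
norms of the optimal block perturbations.\<close>
lemma ck_objective_alt:
  assumes "norm u = 1"
  shows "ck_objective l J X u = sqrt (2 * (norm (J *v u))\<^sup>2 +
           (\<Sum>i\<le>l. 2 * (norm (X i *v u))\<^sup>2 - (u \<bullet> (X i *v u))\<^sup>2))"
  unfolding ck_objective_def
  by (simp add: norm_perp_proj_sq[OF assms] algebra_simps flip: perp_proj_def)

lemma ck_objective_attains_min:
  fixes J :: "real^'n^'n"
  shows "\<exists>u. norm u = 1 \<and> (\<forall>v. norm v = 1 \<longrightarrow> ck_objective l J X u \<le> ck_objective l J X v)"
proof -
  let ?S = "sphere (0 :: real^'n) 1"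
  let ?g = "\<lambda>u. sqrt (2 * (norm (J *v u))\<^sup>2 +
           (\<Sum>i\<le>l. 2 * (norm (X i *v u))\<^sup>2 - (u \<bullet> (X i *v u))\<^sup>2))"
  have "\<exists>u\<in>?S. \<forall>v\<in>?S. ?g u \<le> ?g v"
    by (rule continuous_attains_inf) (auto intro!: continuous_intros)
  then show ?thesis by (auto simp: ck_objective_alt)
qed

lemma block_norm_Delta:
  assumes "(J, X) \<in> structured_tuples l" and "norm u = 1"
  shows "block_norm l (Delta_J u J) (\<lambda>i. Delta_X u (X i)) = ck_objective l J X u"
  using assms
  by (simp add: block_norm_def ck_objective_alt structured_tuples_def psd_def
      Delta_J_eq_Delta_X norm_Delta_X_sq inner_skew_eq_0)

lemma Delta_in_ck_perturbations:
  assumes "(J, X) \<in> structured_tuples l" and u: "norm u = 1"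
  shows "(Delta_J u J, \<lambda>i. Delta_X u (X i)) \<in> ck_perturbations l J X"
proof -
  from assms have J: "transpose J = - J" and X: "\<And>i. i \<le> l \<Longrightarrow> psd (X i)"
    by (auto simp: structured_tuples_def)
  have "transpose (J + Delta_J u J) = - (J + Delta_J u J)"
    unfolding Delta_J_eq_Delta_X[OF J] add_Delta_X transpose_compression J
    by (rule matrix_mult_uminus_middle)
  moreover have "psd (X i + Delta_X u (X i))" if "i \<le> l" for i
    unfolding add_Delta_X by (rule psd_compression[OF X[OF that]])
  moreover have "u \<in> mat_ker (J + Delta_J u J) \<inter> (\<Inter>i\<le>l. mat_ker (X i + Delta_X u (X i)))"
    using Delta_X_mult_kernel_vec[OF u] by (simp add: mat_ker_def Delta_J_eq_Delta_X[OF J])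
  moreover have "u \<noteq> 0" using u by auto
  ultimately show ?thesis unfolding ck_perturbations_def structured_tuples_def by blast
qed

lemma ck_perturbation_norm_ge_objective:
  assumes JX: "(J, X) \<in> structured_tuples l" and DE: "(D, E) \<in> ck_perturbations l J X"
  shows "\<exists>u. norm u = 1 \<and> ck_objective l J X u \<le> block_norm l D E"
proof -
  from JX DE have sym: "transpose J = - J" "transpose (J + D) = - (J + D)"
    "\<And>i. i \<le> l \<Longrightarrow> transpose (X i) = X i" "\<And>i. i \<le> l \<Longrightarrow> transpose (X i + E i) = X i + E i"
    by (auto simp: structured_tuples_def ck_perturbations_def psd_def)
  have D: "transpose D = - D" using sym(1,2) by (simp add: transpose_add)
  have E: "transpose (E i) = E i" if "i \<le> l" for i
    using sym(3,4)[OF that] by (simp add: transpose_add)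
  let ?K = "mat_ker (J + D) \<inter> (\<Inter>i\<le>l. mat_ker (X i + E i))"
  have "0 \<in> ?K" by (simp add: mat_ker_def)
  moreover have "?K \<noteq> {0}" using DE by (simp add: ck_perturbations_def)
  ultimately obtain v where v: "v \<in> ?K" "v \<noteq> 0" by blast
  define u where "u = v /\<^sub>R norm v"
  have u: "norm u = 1" using v(2) by (simp add: u_def)
  have ker: "(J + D) *v u = 0" "\<And>i. i \<le> l \<Longrightarrow> (X i + E i) *v u = 0"
    using v(1) by (auto simp: u_def mat_ker_def matrix_vector_mult_scaleR)
  have "2 * (norm (J *v u))\<^sup>2 \<le> (norm D)\<^sup>2"
    using norm_perturbation_sq_ge[OF u _ ker(1)] D by (simp add: inner_skew_eq_0[OF sym(1)])
  moreover have "(\<Sum>i\<le>l. 2 * (norm (X i *v u))\<^sup>2 - (u \<bullet> (X i *v u))\<^sup>2) \<le> (\<Sum>i\<le>l. (norm (E i))\<^sup>2)"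
    by (intro sum_mono norm_perturbation_sq_ge[OF u _ ker(2)]) (auto simp: E)
  ultimately show ?thesis
    using u unfolding block_norm_def ck_objective_alt[OF u]
    by (intro exI[of _ u]) (simp add: ck_objective_alt)
qed

lemma inner_sum_squares:
  fixes J :: "real^'n^'n"
  assumes "(J, X) \<in> structured_tuples l"
  shows "u \<bullet> ((- (J ** J) + (\<Sum>i\<le>l. X i ** X i)) *v u)
           = (norm (J *v u))\<^sup>2 + (\<Sum>i\<le>l. (norm (X i *v u))\<^sup>2)"
proof -
  from assms have J: "transpose J = - J" and X: "\<And>i. i \<le> l \<Longrightarrow> transpose (X i) = X i"
    by (auto simp: structured_tuples_def psd_def)
  have sum_mult: "(\<Sum>i\<in>S. A i) *v u = (\<Sum>i\<in>S. A i *v u)"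
    if "finite S" for S :: "nat set" and A :: "nat \<Rightarrow> real^'n^'n"
    using that by (induction S rule: finite_induct) (simp_all add: matrix_vector_mult_add_rdistrib)
  have "u \<bullet> ((J ** J) *v u) = - (norm (J *v u))\<^sup>2"
    using inner_mult_vec_transpose[of u J "J *v u"]
    by (simp only: J uminus_matrix_mult_vec)
       (simp add: power2_norm_eq_inner matrix_vector_mul_assoc)
  moreover have "u \<bullet> ((X i ** X i) *v u) = (norm (X i *v u))\<^sup>2" if "i \<le> l" for i
    using inner_mult_vec_transpose[of u "X i" "X i *v u"]
    by (simp only: X[OF that] power2_norm_eq_inner matrix_vector_mul_assoc)
  ultimately show ?thesis
    by (simp add: matrix_vector_mult_add_rdistrib inner_add_right uminus_matrix_mult_vec
        sum_mult inner_sum_right del: uminus_add_conv_diff)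
qed

lemma transpose_sum_squares:
  fixes J :: "real^'n^'n"
  assumes "(J, X) \<in> structured_tuples l"
  defines "M \<equiv> - (J ** J) + (\<Sum>i\<le>l. X i ** X i)"
  shows "transpose M = M"
proof -
  from assms have J: "transpose J = - J" and X: "\<And>i. i \<le> l \<Longrightarrow> transpose (X i) = X i"
    by (auto simp: structured_tuples_def psd_def)
  have sum: "transpose (\<Sum>i\<in>S. A i) = (\<Sum>i\<in>S. transpose (A i))"
    for S :: "nat set" and A :: "nat \<Rightarrow> real^'n^'n"
    by (simp add: transpose_def vec_eq_iff)
  have "transpose (J ** J) = J ** J"
    unfolding matrix_transpose_mul J matrix_eq
    by (simp add: uminus_matrix_mult_vec vec.neg flip: matrix_vector_mul_assoc)
  moreover have "transpose (X i ** X i) = X i ** X i" if "i \<le> l" for i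
    by (simp only: matrix_transpose_mul X[OF that])
  ultimately show ?thesis
    unfolding M_def transpose_add transpose_uminus sum by simp
qed

lemma ck_objective_bounds:
  fixes J :: "real^'n^'n" and X :: "nat \<Rightarrow> real^'n^'n" and l :: nat
  assumes u: "norm u = 1"
  defines "q \<equiv> (norm (J *v u))\<^sup>2 + (\<Sum>i\<le>l. (norm (X i *v u))\<^sup>2)"
  shows "sqrt q \<le> ck_objective l J X u" "ck_objective l J X u \<le> sqrt (2 * q)"
proof -
  have "(u \<bullet> (X i *v u))\<^sup>2 \<le> (norm (X i *v u))\<^sup>2" for i
    using Cauchy_Schwarz_ineq2[of u "X i *v u"] u by (simp flip: abs_le_square_iff)
  then have "(\<Sum>i\<le>l. (norm (X i *v u))\<^sup>2)
      \<le> (\<Sum>i\<le>l. 2 * (norm (X i *v u))\<^sup>2 - (u \<bullet> (X i *v u))\<^sup>2)"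
    by (intro sum_mono) (smt (verit))
  moreover have "(\<Sum>i\<le>l. 2 * (norm (X i *v u))\<^sup>2 - (u \<bullet> (X i *v u))\<^sup>2)
      \<le> 2 * (\<Sum>i\<le>l. (norm (X i *v u))\<^sup>2)"
    unfolding sum_distrib_left by (intro sum_mono) simp
  ultimately show "sqrt q \<le> ck_objective l J X u" "ck_objective l J X u \<le> sqrt (2 * q)"
    unfolding ck_objective_alt[OF u] q_def real_sqrt_le_iff distrib_left
    using zero_le_power2[of "norm (J *v u)"] by linarith+
qed

theorem theorem13:
  fixes l :: nat and J :: "real^'n^'n" and X :: "nat \<Rightarrow> real^'n^'n"
  assumes "(J, X) \<in> structured_tuples l"
  shows "(\<exists>u. norm u = 1 \<and>
            (Delta_J u J, \<lambda>i. Delta_X u (X i)) \<in> ck_perturbations l J X \<and>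
            d_ck l J X = block_norm l (Delta_J u J) (\<lambda>i. Delta_X u (X i))) \<and>
         (\<exists>u. norm u = 1 \<and> d_ck l J X = ck_objective l J X u) \<and>
         (\<forall>u. norm u = 1 \<longrightarrow> d_ck l J X \<le> ck_objective l J X u) \<and>
         sqrt (lambda_min (- (J ** J) + (\<Sum>i\<le>l. X i ** X i))) \<le> d_ck l J X \<and>
         d_ck l J X \<le> sqrt (2 * lambda_min (- (J ** J) + (\<Sum>i\<le>l. X i ** X i)))"
proof -
  let ?M = "- (J ** J) + (\<Sum>i\<le>l. X i ** X i)"
  obtain u where u: "norm u = 1"
    and min: "\<And>v. norm v = 1 \<Longrightarrow> ck_objective l J X u \<le> ck_objective l J X v"
    using ck_objective_attains_min by blast
  note mem = Delta_in_ck_perturbations[OF assms u]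
  note val = block_norm_Delta[OF assms u]
  have d: "d_ck l J X = ck_objective l J X u"
    unfolding d_ck_def
  proof (rule cInf_eq_minimum)
    show "ck_objective l J X u \<in> (\<lambda>(D, E). block_norm l D E) ` ck_perturbations l J X"
      using mem by (rule rev_image_eqI) (simp add: val)
  next
    fix y assume "y \<in> (\<lambda>(D, E). block_norm l D E) ` ck_perturbations l J X"
    then obtain D E where "(D, E) \<in> ck_perturbations l J X" and y: "y = block_norm l D E" by auto
    from ck_perturbation_norm_ge_objective[OF assms this(1)] min
    show "ck_objective l J X u \<le> y" unfolding y by force
  qed
  note Rayleigh = lambda_min_Rayleigh[OF transpose_sum_squares[OF assms],
      unfolded inner_sum_squares[OF assms]]
  have "sqrt (lambda_min ?M) \<le> ck_objective l J X u"
    using real_sqrt_le_mono[OF Rayleigh(2)[OF u]] ck_objective_bounds(1)[OF u]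
    by (rule order_trans)
  moreover have "ck_objective l J X u \<le> sqrt (2 * lambda_min ?M)"
  proof -
    obtain w where w: "norm w = 1"
      "(norm (J *v w))\<^sup>2 + (\<Sum>i\<le>l. (norm (X i *v w))\<^sup>2) = lambda_min ?M"
      using Rayleigh(1) by blast
    have "ck_objective l J X u \<le> ck_objective l J X w" by (rule min[OF w(1)])
    also have "\<dots> \<le> sqrt (2 * lambda_min ?M)"
      using ck_objective_bounds(2)[OF w(1), of l J X] unfolding w(2) .
    finally show ?thesis .
  qed
  ultimately show ?thesis using u mem val min d by auto
qed

end
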